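(* A graph $G$ is switching equivalent to a threshold graph if and only if $G$ has no induced subgraph which is switching equivalent to $3K_2$, to $C_5$, or to $C_4+2K_1$.
   Context: Graphs are finite and simple. A threshold graph is a graph in which every induced subgraph has an isolated vertex or a universal vertex. For $G=(V,E)$ and $S\subseteq V$, switching $G$ with respect to $S$ means: for every pair $\{u,v\}$ with $u\in S$, $v\notin S$, add the edge if absent and remove it if present; other pairs are unchanged. Two graphs on the same vertex set are switching equivalent if one is obtained from the other by switching with respect to some subset. $3K_2$ is three disjoint edges, $C_5$ is the 5-cycle, and $C_4+2K_1$ is a 4-cycle plus two isolated vertices. *)

theory Defs
  imports Main
begin

datatype 'a ugraph = Graph (verts: "'a set") (edges: "'a set set")

definition fin_simple_graph :: "'a ugraph \<Rightarrow> bool" where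
  "fin_simple_graph G \<longleftrightarrow>
     finite (verts G) \<and> (\<forall>e\<in>edges G. e \<subseteq> verts G \<and> card e = 2)"

definition induced :: "'a ugraph \<Rightarrow> 'a set \<Rightarrow> 'a ugraph" where
  "induced G W = Graph W {e \<in> edges G. e \<subseteq> W}"

definition isolated_vertex :: "'a ugraph \<Rightarrow> 'a \<Rightarrow> bool" where
  "isolated_vertex G v \<longleftrightarrow> v \<in> verts G \<and> (\<forall>u\<in>verts G. {u, v} \<notin> edges G)"

definition universal_vertex :: "'a ugraph \<Rightarrow> 'a \<Rightarrow> bool" where
  "universal_vertex G v \<longleftrightarrow> v \<in> verts G \<and> (\<forall>u\<in>verts G - {v}. {u, v} \<in> edges G)"

text \<open>The empty induced subgraph has no vertex at all and is excluded.\<close>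

definition threshold_graph :: "'a ugraph \<Rightarrow> bool" where
  "threshold_graph G \<longleftrightarrow> fin_simple_graph G \<and>
     (\<forall>W\<subseteq>verts G. W \<noteq> {} \<longrightarrow>
        (\<exists>v. isolated_vertex (induced G W) v \<or> universal_vertex (induced G W) v))"

definition cut_pairs :: "'a ugraph \<Rightarrow> 'a set \<Rightarrow> 'a set set" where
  "cut_pairs G S = {{u, v} | u v. u \<in> S \<and> v \<in> verts G - S}"

definition switch :: "'a ugraph \<Rightarrow> 'a set \<Rightarrow> 'a ugraph" where
  "switch G S = Graph (verts G) ((edges G - cut_pairs G S) \<union> (cut_pairs G S - edges G))"

definition switching_equivalent :: "'a ugraph \<Rightarrow> 'a ugraph \<Rightarrow> bool" where
  "switching_equivalent G H \<longleftrightarrow> (\<exists>S\<subseteq>verts G. H = switch G S)"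

definition isomorphic :: "'a ugraph \<Rightarrow> 'b ugraph \<Rightarrow> bool" where
  "isomorphic G H \<longleftrightarrow> (\<exists>f. bij_betw f (verts G) (verts H) \<and>
     (\<forall>u\<in>verts G. \<forall>v\<in>verts G. {u, v} \<in> edges G \<longleftrightarrow> {f u, f v} \<in> edges H))"

text \<open>Switching relates graphs on one vertex set, so being switching equivalent to a named
  graph such as \<open>C\<^sub>5\<close> means being switching equivalent to an isomorphic copy of it.\<close>

definition switching_equivalent_to_copy :: "'a ugraph \<Rightarrow> 'b ugraph \<Rightarrow> bool" where
  "switching_equivalent_to_copy G K \<longleftrightarrow>
     (\<exists>H. isomorphic H K \<and> switching_equivalent G H)"

definition graph_3K2 :: "nat ugraph" where
  "graph_3K2 = Graph {0, 1, 2, 3, 4, 5} {{0, 1}, {2, 3}, {4, 5}}"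

definition graph_C5 :: "nat ugraph" where
  "graph_C5 = Graph {0, 1, 2, 3, 4} {{0, 1}, {1, 2}, {2, 3}, {3, 4}, {4, 0}}"

definition graph_C4_2K1 :: "nat ugraph" where
  "graph_C4_2K1 = Graph {0, 1, 2, 3, 4, 5} {{0, 1}, {1, 2}, {2, 3}, {3, 0}}"

lemma switch_switch: "switch (switch G S) S = G"
  by (cases G) (auto simp: switch_def cut_pairs_def)

lemma switching_equivalent_sym:
  "switching_equivalent G H \<longleftrightarrow> switching_equivalent H G"
proof -
  have "switching_equivalent B A" if "switching_equivalent A B" for A B :: "'a ugraph"
  proof -
    from that obtain S where S: "S \<subseteq> verts A" "B = switch A S"
      by (auto simp: switching_equivalent_def)
    then have "S \<subseteq> verts B" "A = switch B S"
      by (simp_all add: switch_switch) (simp add: switch_def)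
    then show ?thesis by (auto simp: switching_equivalent_def)
  qed
  then show ?thesis by blast
qed

lemma fin_simple_graph_induced:
  "fin_simple_graph G \<Longrightarrow> W \<subseteq> verts G \<Longrightarrow> fin_simple_graph (induced G W)"
  by (auto simp: fin_simple_graph_def induced_def intro: finite_subset)

lemma fin_simple_graph_switch:
  assumes "fin_simple_graph G" and "S \<subseteq> verts G"
  shows "fin_simple_graph (switch G S)"
proof -
  have "e \<subseteq> verts G \<and> card e = 2" if "e \<in> cut_pairs G S" for e
  proof -
    from that obtain u v where "e = {u, v}" "u \<in> S" "v \<in> verts G" "v \<notin> S"
      by (auto simp: cut_pairs_def)
    with assms(2) show ?thesis by (auto simp: card_2_iff)
  qed
  with assms(1) show ?thesis by (auto simp: fin_simple_graph_def switch_def)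
qed

end

theory Submission
  imports Defs
begin

text \<open>A threshold graph has no alternating 4-cycle (edges \<open>ab\<close>, \<open>cd\<close>, non-edges \<open>ac\<close>, \<open>bd\<close>), whereas
  every switching of \<open>3K\<^sub>2\<close>, \<open>C\<^sub>5\<close> or \<open>C\<^sub>4 + 2K\<^sub>1\<close> has one.

  Conversely, switch so that some vertex \<open>x\<close> becomes isolated. Excluding the switching class of \<open>C\<^sub>5\<close>
  means that the rest has no induced \<open>P\<^sub>4\<close>, hence it or its complement is disconnected; the other
  two classes, which are complementary, exclude \<open>C\<^sub>4 + K\<^sub>1\<close>, the bowtie, \<open>3K\<^sub>2\<close> and its complement.
  It follows that the rest is the disjoint union or the join of two threshold graphs \<open>A\<close> and \<open>B\<close>.
  Listing \<open>A\<close> in threshold order, then \<open>x\<close>, then \<open>B\<close> in reverse threshold order gives a threshold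
  order of a switching of the whole graph.\<close>

section \<open>Configurations, splittings and orders for adjacency relations\<close>

text \<open>Arbitrary relations take the place of graphs so that complementation is plain negation.
  The complement of a loopless relation holds on the diagonal, which is harmless: every
  configuration only tests pairs of distinct vertices.\<close>

definition alternating :: "('a \<Rightarrow> 'a \<Rightarrow> bool) \<Rightarrow> 'a \<Rightarrow> 'a \<Rightarrow> 'a \<Rightarrow> 'a \<Rightarrow> bool" where
  "alternating E a b c d \<longleftrightarrow> distinct [a, b, c, d] \<and> E a b \<and> E c d \<and> \<not> E a c \<and> \<not> E b d"

definition path4 :: "('a \<Rightarrow> 'a \<Rightarrow> bool) \<Rightarrow> 'a \<Rightarrow> 'a \<Rightarrow> 'a \<Rightarrow> 'a \<Rightarrow> bool" where
  "path4 E a b c d \<longleftrightarrow> distinct [a, b, c, d] \<and>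
     E a b \<and> E b c \<and> E c d \<and> \<not> E a c \<and> \<not> E a d \<and> \<not> E b d"

definition cycle4 :: "('a \<Rightarrow> 'a \<Rightarrow> bool) \<Rightarrow> 'a \<Rightarrow> 'a \<Rightarrow> 'a \<Rightarrow> 'a \<Rightarrow> bool" where
  "cycle4 E a b c d \<longleftrightarrow> distinct [a, b, c, d] \<and>
     E a b \<and> E b c \<and> E c d \<and> E d a \<and> \<not> E a c \<and> \<not> E b d"

definition matching2 :: "('a \<Rightarrow> 'a \<Rightarrow> bool) \<Rightarrow> 'a \<Rightarrow> 'a \<Rightarrow> 'a \<Rightarrow> 'a \<Rightarrow> bool" where
  "matching2 E a b c d \<longleftrightarrow> distinct [a, b, c, d] \<and>
     E a b \<and> E c d \<and> \<not> E a c \<and> \<not> E a d \<and> \<not> E b c \<and> \<not> E b d"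

definition path4_free :: "'a set \<Rightarrow> ('a \<Rightarrow> 'a \<Rightarrow> bool) \<Rightarrow> bool" where
  "path4_free V E \<longleftrightarrow> (\<forall>a\<in>V. \<forall>b\<in>V. \<forall>c\<in>V. \<forall>d\<in>V. \<not> path4 E a b c d)"

definition cycle4_point_free :: "'a set \<Rightarrow> ('a \<Rightarrow> 'a \<Rightarrow> bool) \<Rightarrow> bool" where
  "cycle4_point_free V E \<longleftrightarrow> (\<forall>a\<in>V. \<forall>b\<in>V. \<forall>c\<in>V. \<forall>d\<in>V. \<forall>z\<in>V - {a, b, c, d}.
     cycle4 E a b c d \<longrightarrow> E z a \<or> E z b \<or> E z c \<or> E z d)"

definition bowtie_free :: "'a set \<Rightarrow> ('a \<Rightarrow> 'a \<Rightarrow> bool) \<Rightarrow> bool" where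
  "bowtie_free V E \<longleftrightarrow> (\<forall>a\<in>V. \<forall>b\<in>V. \<forall>c\<in>V. \<forall>d\<in>V. \<forall>z\<in>V - {a, b, c, d}.
     matching2 E a b c d \<longrightarrow> \<not> (E z a \<and> E z b \<and> E z c \<and> E z d))"

definition matching3_free :: "'a set \<Rightarrow> ('a \<Rightarrow> 'a \<Rightarrow> bool) \<Rightarrow> bool" where
  "matching3_free V E \<longleftrightarrow> (\<forall>a\<in>V. \<forall>b\<in>V. \<forall>c\<in>V. \<forall>d\<in>V. \<forall>e\<in>V. \<forall>f\<in>V.
     \<not> (matching2 E a b c d \<and> matching2 E a b e f \<and> matching2 E c d e f))"

text \<open>\<open>c = False\<close> is a disjoint union, \<open>c = True\<close> a join. With the
  colour as a parameter, complementation merely flips it. Either side may be empty.\<close>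

definition split_by :: "('a \<Rightarrow> 'a \<Rightarrow> bool) \<Rightarrow> bool \<Rightarrow> 'a set \<Rightarrow> 'a set \<Rightarrow> bool" where
  "split_by E c A B \<longleftrightarrow> A \<inter> B = {} \<and> (\<forall>a\<in>A. \<forall>b\<in>B. E a b = c)"

definition splittable :: "'a set \<Rightarrow> ('a \<Rightarrow> 'a \<Rightarrow> bool) \<Rightarrow> bool" where
  "splittable V E \<longleftrightarrow> (\<exists>A B c. A \<noteq> {} \<and> B \<noteq> {} \<and> A \<union> B = V \<and> split_by E c A B)"

text \<open>This is the usual construction sequence: \<open>t v\<close> tells whether
  \<open>v\<close> is added as a dominating or as an isolated vertex.\<close>

definition threshold_order :: "'a set \<Rightarrow> ('a \<Rightarrow> 'a \<Rightarrow> bool) \<Rightarrow> bool" where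
  "threshold_order V E \<longleftrightarrow>
     (\<exists>xs t. distinct xs \<and> set xs = V \<and> sorted_wrt (\<lambda>u v. E u v = t v) xs)"

text \<open>The switching set is pulled back to a Boolean function \<open>s\<close> on
  \<open>K\<close>, so that for a concrete \<open>K\<close> only finitely many cases of
  \<open>s\<close> matter.\<close>

definition switch_embeds :: "'b ugraph \<Rightarrow> 'a set \<Rightarrow> ('a \<Rightarrow> 'a \<Rightarrow> bool) \<Rightarrow> bool" where
  "switch_embeds K V E \<longleftrightarrow> (\<exists>g (s :: 'b \<Rightarrow> bool). inj_on g (verts K) \<and> g ` verts K \<subseteq> V \<and>
     (\<forall>i\<in>verts K. \<forall>j\<in>verts K. i \<noteq> j \<longrightarrow>
        ({i, j} \<in> edges K) = (E (g i) (g j) \<noteq> (s i \<noteq> s j))))"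

subsection \<open>Splitting graphs without induced paths on four vertices\<close>

lemma symp_commute: "symp E \<Longrightarrow> E u v = E v u"
  by (auto simp: symp_def)

lemma symp_compl: "symp E \<Longrightarrow> symp (\<lambda>u v. \<not> E u v)"
  by (auto simp: symp_def)

text \<open>P4 is self-complementary: its complement is again a path, with inner vertices
  \<open>d\<close> and \<open>a\<close>.\<close>

lemma path4_compl:
  "symp E \<Longrightarrow> path4 (\<lambda>u v. \<not> E u v) a b c d = path4 E b d a c"
  unfolding path4_def using symp_commute[of E] by auto

lemma path4_free_compl:
  "symp E \<Longrightarrow> path4_free V (\<lambda>u v. \<not> E u v) = path4_free V E"
  unfolding path4_free_def path4_compl by blast

lemma matching2_compl:
  "symp E \<Longrightarrow> matching2 (\<lambda>u v. \<not> E u v) a b c d = cycle4 E a c b d"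
  unfolding matching2_def cycle4_def using symp_commute[of E] by auto

lemma cycle4_compl:
  "symp E \<Longrightarrow> cycle4 (\<lambda>u v. \<not> E u v) a b c d = matching2 E a c b d"
  unfolding matching2_def cycle4_def using symp_commute[of E] by auto

lemma bowtie_free_compl:
  "symp E \<Longrightarrow> cycle4_point_free V E \<Longrightarrow> bowtie_free V (\<lambda>u v. \<not> E u v)"
  unfolding bowtie_free_def cycle4_point_free_def matching2_compl
  by (simp add: Ball_def) blast

lemma cycle4_point_free_compl:
  "symp E \<Longrightarrow> bowtie_free V E \<Longrightarrow> cycle4_point_free V (\<lambda>u v. \<not> E u v)"
  unfolding bowtie_free_def cycle4_point_free_def cycle4_compl
  by (simp add: Ball_def)

lemma splittable_compl: "splittable V (\<lambda>u v. \<not> E u v) = splittable V E"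
proof -
  have "splittable V (\<lambda>u v. \<not> F u v)" if "splittable V F" for F
  proof -
    from that obtain A B c where "A \<noteq> {}" "B \<noteq> {}" "A \<union> B = V" "split_by F c A B"
      unfolding splittable_def by blast
    moreover from this have "split_by (\<lambda>u v. \<not> F u v) (\<not> c) A B"
      unfolding split_by_def by blast
    ultimately show ?thesis unfolding splittable_def by blast
  qed
  from this[of E] this[of "\<lambda>u v. \<not> E u v"] show ?thesis by auto
qed

lemma split_by_sym: "symp E \<Longrightarrow> split_by E c A B \<Longrightarrow> split_by E c B A"
  unfolding split_by_def symp_def by blast

lemma splittableI:
  "A \<noteq> {} \<Longrightarrow> B \<noteq> {} \<Longrightarrow> A \<union> B = V \<Longrightarrow> split_by E c A B \<Longrightarrow> splittable V E"
  unfolding splittable_def by blast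

text \<open>If \<open>v\<close> has a neighbour in \<open>B\<close>, then an edge between a neighbour and a non-neighbour of \<open>v\<close>
  in \<open>A\<close> would extend to an induced path, so the non-neighbours of \<open>v\<close> in \<open>A\<close> split off.\<close>

lemma splittable_insert_nonneighbour:
  assumes sym: "symp E" and free: "path4_free (insert v (A \<union> B)) E"
    and AB: "split_by E False A B" and v: "v \<notin> A \<union> B"
    and b: "b \<in> B" "E v b" and q: "q \<in> A" "\<not> E v q"
  shows "splittable (insert v (A \<union> B)) E"
proof -
  define Q where "Q = {a \<in> A. \<not> E v a}"
  have "\<not> E p r" if "p \<in> A - Q" "r \<in> Q" for p r
  proof
    assume "E p r"
    with that AB v b have "path4 E b v p r"
      using symp_commute[OF sym] unfolding path4_def Q_def split_by_def by auto
    with free that b show False unfolding path4_free_def Q_def by blast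
  qed
  then have "split_by E False Q (insert v (A \<union> B) - Q)"
    using sym AB unfolding split_by_def Q_def symp_def by blast
  moreover have "Q \<noteq> {}" using q by (auto simp: Q_def)
  moreover have "insert v (A \<union> B) - Q \<noteq> {}" "Q \<union> (insert v (A \<union> B) - Q) = insert v (A \<union> B)"
    using v by (auto simp: Q_def)
  ultimately show ?thesis by (intro splittableI)
qed

text \<open>If \<open>v\<close> misses one side, it joins the other; if it sees everything, it
  splits off alone. Otherwise it has a neighbour on one side and a non-neighbour on the other, and
  \<open>splittable_insert_nonneighbour\<close> applies.\<close>

lemma splittable_insert:
  assumes sym: "symp E" and free: "path4_free (insert v (A \<union> B)) E"
    and AB: "split_by E False A B" and v: "v \<notin> A \<union> B" and ne: "A \<noteq> {}" "B \<noteq> {}"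
  shows "splittable (insert v (A \<union> B)) E"
proof -
  have BA: "split_by E False B A" by (rule split_by_sym[OF sym AB])
  consider "\<forall>a\<in>A. \<not> E v a" | "\<forall>b\<in>B. \<not> E v b" | "\<forall>u\<in>A \<union> B. E v u"
    | b q where "b \<in> B" "E v b" "q \<in> A" "\<not> E v q"
    | b q where "b \<in> A" "E v b" "q \<in> B" "\<not> E v q"
    by blast
  then show ?thesis
  proof cases
    case 1
    then have "split_by E False (insert v B) A" using BA v unfolding split_by_def by auto
    then show ?thesis using ne by (intro splittableI[of "insert v B" A]) auto
  next
    case 2
    then have "split_by E False (insert v A) B" using AB v unfolding split_by_def by auto
    then show ?thesis using ne by (intro splittableI[of "insert v A" B]) auto
  next
    case 3
    then have "split_by E True {v} (A \<union> B)" using v unfolding split_by_def by auto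
    then show ?thesis using ne by (intro splittableI[of "{v}" "A \<union> B"]) auto
  next
    case 4
    then show ?thesis by (rule splittable_insert_nonneighbour[OF sym free AB v])
  next
    case 5
    have "splittable (insert v (B \<union> A)) E"
      using 5 free v by (intro splittable_insert_nonneighbour[OF sym _ BA]) (auto simp: Un_commute)
    then show ?thesis by (simp add: Un_commute)
  qed
qed

lemma path4_free_mono: "path4_free V E \<Longrightarrow> W \<subseteq> V \<Longrightarrow> path4_free W E"
  unfolding path4_free_def by blast

text \<open>Seinsche's theorem on cographs, by adding one vertex at a time. A join is turned into a
  disjoint union by complementing.\<close>

lemma path4_free_splittable:
  assumes "finite V" "2 \<le> card V" "symp E" "path4_free V E"
  shows "splittable V E"
  using assms
proof (induction V rule: finite_induct)
  case empty
  then show ?case by simp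
next
  case (insert v F)
  show ?case
  proof (cases "card F = 1")
    case True
    then obtain w where F: "F = {w}" by (rule card_1_singletonE)
    with insert.hyps have "split_by E (E v w) {v} {w}" by (auto simp: split_by_def)
    then show ?thesis using F by (intro splittableI[of "{v}" "{w}"]) auto
  next
    case False
    with insert have "splittable F E" by (auto intro: path4_free_mono)
    then obtain A B c where AB: "A \<noteq> {}" "B \<noteq> {}" "A \<union> B = F" "split_by E c A B"
      unfolding splittable_def by blast
    show ?thesis
    proof (cases c)
      case False
      then show ?thesis using splittable_insert[of E v A B] AB insert by auto
    next
      case True
      then have "split_by (\<lambda>u v. \<not> E u v) False A B" using AB by (auto simp: split_by_def)
      then have "splittable (insert v F) (\<lambda>u v. \<not> E u v)"
        using splittable_insert[of "\<lambda>u v. \<not> E u v" v A B] AB insert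
        by (auto simp: symp_compl path4_free_compl)
      then show ?thesis by (simp add: splittable_compl)
    qed
  qed
qed

subsection \<open>Threshold orders\<close>

lemma path4_alternating: "path4 E a b c d \<Longrightarrow> alternating E a b c d"
  unfolding path4_def alternating_def by simp

text \<open>Only the pairs \<open>b\<close>, \<open>c\<close> and \<open>a\<close>, \<open>d\<close>
  are free. Both adjacent give C4, neither gives 2K2, exactly one gives a P4.\<close>

lemma alternating_cases:
  assumes "symp E" "alternating E a b c d"
  shows "path4 E a b c d \<or> path4 E b a d c \<or> cycle4 E a b c d \<or> matching2 E a b c d"
  using assms(2) symp_commute[OF assms(1)]
  unfolding path4_def alternating_def cycle4_def matching2_def by auto

text \<open>Across a splitting of colour \<open>c\<close> every vertex sees only \<open>c\<close>.
  If \<open>a\<close> and \<open>b\<close> on opposite sides both fail to be extreme, each has a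
  partner of the other colour on its own side, and these four vertices form an alternating
  4-cycle.\<close>

lemma no_alternating_extreme_vertex:
  assumes "finite V" "V \<noteq> {}" "symp E"
    and free: "\<forall>a\<in>V. \<forall>b\<in>V. \<forall>c\<in>V. \<forall>d\<in>V. \<not> alternating E a b c d"
  shows "\<exists>v\<in>V. \<exists>c. \<forall>u\<in>V - {v}. E u v = c"
proof (cases "card V = 1")
  case True
  then show ?thesis by (auto simp: card_1_singleton_iff)
next
  case False
  have "path4_free V E" using free unfolding path4_free_def by (meson path4_alternating)
  moreover have "2 \<le> card V" using False assms(1,2) by (cases "card V") auto
  ultimately have "splittable V E" using assms(1,3) by (intro path4_free_splittable)
  then obtain A B c where AB: "A \<noteq> {}" "B \<noteq> {}" "A \<union> B = V" "split_by E c A B"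
    unfolding splittable_def by blast
  show ?thesis
  proof (rule ccontr)
    assume none: "\<not> ?thesis"
    from AB obtain a b where ab: "a \<in> A" "b \<in> B" by blast
    then have "a \<in> V" "b \<in> V" using AB(3) by auto
    with none have "\<exists>u\<in>V - {a}. E u a \<noteq> c" "\<exists>u\<in>V - {b}. E u b \<noteq> c" by blast+
    then obtain a' b' where a'b': "a' \<in> V - {a}" "E a' a \<noteq> c" "b' \<in> V - {b}" "E b' b \<noteq> c"
      by blast
    have "a' \<notin> B" using a'b'(2) ab AB(4) symp_commute[OF assms(3), of a' a]
      unfolding split_by_def by blast
    moreover have "b' \<notin> A" using a'b'(4) ab AB(4) unfolding split_by_def by blast
    ultimately have "a' \<in> A - {a}" "b' \<in> B - {b}" using a'b' AB(3) by blast+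
    moreover from this have "E a b = c" "E a' b' = c" "E a b' = c" "E a' b = c"
      using AB(4) ab unfolding split_by_def by blast+
    moreover have "E a a' \<noteq> c" "E b b' \<noteq> c" using a'b' sympD[OF assms(3)] by blast+
    moreover have "a \<noteq> b" "a \<noteq> b'" "a' \<noteq> b" "a' \<noteq> b'"
      using AB(4) ab calculation(1,2) unfolding split_by_def by blast+
    ultimately have "alternating E a a' b b' \<or> alternating E a b a' b'"
      unfolding alternating_def by (cases c) auto
    then show False using free \<open>a \<in> V\<close> \<open>b \<in> V\<close> a'b'(1,3) by blast
  qed
qed

lemma no_alternating_threshold_order:
  assumes "finite V" "symp E"
    and "\<forall>a\<in>V. \<forall>b\<in>V. \<forall>c\<in>V. \<forall>d\<in>V. \<not> alternating E a b c d"
  shows "threshold_order V E"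
  using assms
proof (induction V rule: finite_psubset_induct)
  case (psubset V)
  show ?case
  proof (cases "V = {}")
    case True
    then show ?thesis by (auto simp: threshold_order_def)
  next
    case False
    with psubset obtain v c where v: "v \<in> V" "\<forall>u\<in>V - {v}. E u v = c"
      using no_alternating_extreme_vertex[of V E] by blast
    then have "threshold_order (V - {v}) E" using psubset by (intro psubset.IH) auto
    then obtain xs t where xs: "distinct xs" "set xs = V - {v}"
      "sorted_wrt (\<lambda>u v. E u v = t v) xs"
      unfolding threshold_order_def by blast
    \<comment> \<open>The extreme vertex goes last. It does not occur in \<open>xs\<close>, so the
      update leaves the earlier colours alone.\<close>
    from xs(3) have "sorted_wrt (\<lambda>u w. E u w = (t(v := c)) w) xs"
      by (rule sorted_wrt_mono_rel[rotated]) (use xs(2) in auto)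
    then have "distinct (xs @ [v])" "set (xs @ [v]) = V"
      "sorted_wrt (\<lambda>u w. E u w = (t(v := c)) w) (xs @ [v])"
      using xs v by (auto simp: sorted_wrt_append)
    then show ?thesis unfolding threshold_order_def by blast
  qed
qed

lemma threshold_order_compl: "threshold_order V (\<lambda>u v. \<not> E u v) \<Longrightarrow> threshold_order V E"
proof -
  assume "threshold_order V (\<lambda>u v. \<not> E u v)"
  then obtain xs t where xs: "distinct xs" "set xs = V"
    "sorted_wrt (\<lambda>u v. (\<not> E u v) = t v) xs"
    unfolding threshold_order_def by blast
  from xs(3) have "sorted_wrt (\<lambda>u v. E u v = (\<not> t v)) xs"
    by (rule sorted_wrt_mono_rel[rotated]) auto
  with xs show ?thesis
    unfolding threshold_order_def by (intro exI[of _ xs] exI[of _ "\<lambda>v. \<not> t v"]) auto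
qed

subsection \<open>Decomposition into two threshold parts\<close>

text \<open>A C4 would lie on one side and form C4 + K1 with a vertex of the other, so 2K2 is the
  only obstruction left. If it occurs, the non-isolated vertices split into two parts without cross
  edges. Each contains an edge, so a 2K2 in one part would give 3K2 with an edge of the
  other.\<close>

lemma disconnected_two_threshold_parts:
  assumes fin: "finite V" and sym: "symp E"
    and p4: "path4_free V E" and c4: "cycle4_point_free V E"
    and bow: "bowtie_free V E" and m3: "matching3_free V E"
    and AB0: "A0 \<noteq> {}" "B0 \<noteq> {}" "A0 \<union> B0 = V" "split_by E False A0 B0"
  shows "\<exists>A B. A \<union> B = V \<and> split_by E False A B \<and> threshold_order A E \<and> threshold_order B E"
proof -
  have no_c4: "\<not> cycle4 E a b c d" if V: "a \<in> V" "b \<in> V" "c \<in> V" "d \<in> V" for a b c d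
  proof
    assume C: "cycle4 E a b c d"
    have BA0: "split_by E False B0 A0" by (rule split_by_sym[OF sym AB0(4)])
    have *: False if X: "a \<in> X" "split_by E False X Y" "X \<union> Y = V" "Y \<noteq> {}" for X Y
    proof -
      from that C V sym have "b \<in> X" "d \<in> X" "c \<in> X"
        unfolding split_by_def cycle4_def symp_def by blast+
      moreover obtain z where "z \<in> Y" using X(4) by blast
      ultimately have "z \<in> V - {a, b, c, d}" "\<not> E z a" "\<not> E z b" "\<not> E z c" "\<not> E z d"
        using that sym unfolding split_by_def symp_def by blast+
      with c4 C V show False unfolding cycle4_point_free_def by blast
    qed
    show False using *[of A0 B0] *[of B0 A0] AB0 BA0 V by blast
  qed
  have thr: "threshold_order W E"
    if "W \<subseteq> V" "\<forall>a\<in>W. \<forall>b\<in>W. \<forall>c\<in>W. \<forall>d\<in>W. \<not> matching2 E a b c d" for W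
  proof (rule no_alternating_threshold_order[OF _ sym])
    show "finite W" using that(1) fin by (rule finite_subset)
    show "\<forall>a\<in>W. \<forall>b\<in>W. \<forall>c\<in>W. \<forall>d\<in>W. \<not> alternating E a b c d"
    proof (intro ballI notI)
      fix a b c d assume W: "a \<in> W" "b \<in> W" "c \<in> W" "d \<in> W" and "alternating E a b c d"
      then consider "path4 E a b c d" | "path4 E b a d c" | "cycle4 E a b c d"
        | "matching2 E a b c d"
        using alternating_cases[OF sym] by blast
      then show False
        using that W p4 no_c4[of a b c d] unfolding path4_free_def by cases blast+
    qed
  qed
  show ?thesis
  proof (cases "\<forall>a\<in>V. \<forall>b\<in>V. \<forall>c\<in>V. \<forall>d\<in>V. \<not> matching2 E a b c d")
    case True
    then have "threshold_order V E" by (intro thr) auto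
    moreover have "threshold_order {} E" by (auto simp: threshold_order_def)
    moreover have "split_by E False V {}" by (simp add: split_by_def)
    ultimately show ?thesis by blast
  next
    case False
    then obtain a b c d where V: "a \<in> V" "b \<in> V" "c \<in> V" "d \<in> V" and m: "matching2 E a b c d"
      by blast
    \<comment> \<open>Isolated vertices are set aside so that each part of the splitting below
      contains an edge. The diagonal is skipped because \<open>E\<close> may be a
      complement.\<close>
    define I where "I = {v \<in> V. \<forall>u\<in>V - {v}. \<not> E u v}"
    have abcd: "{a, b, c, d} \<subseteq> V - I"
      using V m symp_commute[OF sym] unfolding I_def matching2_def by auto
    have "card {a, b, c, d} = 4" using m by (auto simp: matching2_def)
    moreover have "card {a, b, c, d} \<le> card (V - I)" using fin abcd by (intro card_mono) auto
    ultimately have "2 \<le> card (V - I)" by simp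
    then have "splittable (V - I) E"
      using fin sym path4_free_mono[OF p4] by (intro path4_free_splittable) auto
    then obtain A B col where AB: "A \<noteq> {}" "B \<noteq> {}" "A \<union> B = V - I" "split_by E col A B"
      unfolding splittable_def by blast
    have BA: "split_by E col B A" by (rule split_by_sym[OF sym AB(4)])
    \<comment> \<open>In a join, non-adjacent vertices share a side, so the whole 2K2 lies on one
      side and any vertex of the other completes a bowtie.\<close>
    have "\<not> col"
    proof
      assume col
      have *: False if X: "a \<in> X" "split_by E True X Y" "X \<union> Y = V - I" "Y \<noteq> {}" for X Y
      proof -
        have "c \<in> X" "d \<in> X"
          using that abcd m unfolding split_by_def matching2_def by blast+
        moreover from this have "b \<in> X"
          using that abcd m sym unfolding split_by_def matching2_def symp_def by blast
        moreover obtain z where "z \<in> Y" using X(4) by blast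
        ultimately have "z \<in> V - {a, b, c, d}" "E z a" "E z b" "E z c" "E z d"
          using that sym unfolding split_by_def symp_def by blast+
        with bow m V show False unfolding bowtie_free_def by blast
      qed
      show False using *[of A B] *[of B A] AB BA abcd \<open>col\<close> by auto
    qed
    then have col: "col = False" by simp
    \<comment> \<open>A vertex of \<open>X\<close> is not isolated in \<open>V\<close>; its
      neighbour is not isolated either, and it cannot lie across the splitting.\<close>
    have edge: "\<exists>x\<in>X. \<exists>y\<in>X. x \<noteq> y \<and> E x y"
      if X: "X \<noteq> {}" "split_by E False X Y" "X \<union> Y = V - I" for X Y
    proof -
      obtain x where x: "x \<in> X" using X(1) by blast
      then obtain y where y: "y \<in> V" "y \<noteq> x" "E y x" using X(3) unfolding I_def by blast
      then have "y \<notin> I" using x that(3) sym unfolding I_def symp_def by blast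
      then have "y \<in> X" using x y that(2,3) sym unfolding split_by_def symp_def by blast
      with x y show ?thesis by blast
    qed
    have no_m2: "\<not> matching2 E p q r s"
      if "X \<union> Y = V" "split_by E False X Y" "x \<in> Y" "y \<in> Y" "x \<noteq> y" "E x y"
        "p \<in> X" "q \<in> X" "r \<in> X" "s \<in> X" for X Y x y p q r s
    proof
      assume pqrs: "matching2 E p q r s"
      then have "matching2 E p q x y" "matching2 E r s x y"
        using that unfolding matching2_def split_by_def by auto
      with pqrs m3 that show False unfolding matching3_free_def by blast
    qed
    obtain x y where xy: "x \<in> A" "y \<in> A" "x \<noteq> y" "E x y"
      using edge[of A B] AB col by blast
    obtain z w where zw: "z \<in> B" "w \<in> B" "z \<noteq> w" "E z w"
      using edge[of B A] AB BA col by blast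
    have s1: "split_by E False (A \<union> I) B"
      using AB col sym unfolding split_by_def I_def symp_def by blast
    have un: "(A \<union> I) \<union> B = V" using AB(3) unfolding I_def by blast
    have "threshold_order (A \<union> I) E"
      using no_m2[OF un s1 zw] un by (intro thr) blast+
    moreover have "threshold_order B E"
      using no_m2[of B "A \<union> I" x y] split_by_sym[OF sym s1] xy un by (intro thr) blast+
    ultimately show ?thesis using s1 un by blast
  qed
qed

text \<open>The hypotheses are closed under complementation: P4 is fixed, C4 + K1 and the bowtie are
  exchanged, and so are 3K2 and its complement. The join case is therefore the disconnected case of
  the complement.\<close>

lemma two_threshold_parts:
  assumes fin: "finite V" and sym: "symp E"
    and p4: "path4_free V E" and c4: "cycle4_point_free V E" and bow: "bowtie_free V E"
    and m3: "matching3_free V E" and m3': "matching3_free V (\<lambda>u v. \<not> E u v)"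
  shows "\<exists>A B c. A \<union> B = V \<and> split_by E c A B \<and> threshold_order A E \<and> threshold_order B E"
proof (cases "2 \<le> card V")
  case True
  then obtain A B c where AB: "A \<noteq> {}" "B \<noteq> {}" "A \<union> B = V" "split_by E c A B"
    using path4_free_splittable[OF fin _ sym p4] unfolding splittable_def by blast
  show ?thesis
  proof (cases c)
    case False
    then have "split_by E False A B" using AB(4) by simp
    from disconnected_two_threshold_parts[OF fin sym p4 c4 bow m3 AB(1-3) this]
    show ?thesis by blast
  next
    case True
    let ?F = "\<lambda>u v. \<not> E u v"
    have "split_by ?F False A B" using True AB(4) by (simp add: split_by_def)
    moreover have "path4_free V ?F" using p4 path4_free_compl[OF sym] by simp
    ultimately obtain A' B' where "A' \<union> B' = V" "split_by ?F False A' B'"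
      "threshold_order A' ?F" "threshold_order B' ?F"
      using disconnected_two_threshold_parts[OF fin symp_compl[OF sym] _
          cycle4_point_free_compl[OF sym bow] bowtie_free_compl[OF sym c4] m3' AB(1-3)]
      by blast
    moreover from this have "split_by E True A' B'" by (simp add: split_by_def)
    ultimately show ?thesis using threshold_order_compl by blast
  qed
next
  case False
  then have small: "V = {} \<or> (\<exists>v. V = {v})"
    using fin by (auto simp: not_le less_2_cases_iff card_1_singleton_iff)
  then have "threshold_order V E"
    by (intro no_alternating_threshold_order[OF fin sym]) (auto simp: alternating_def)
  moreover have "threshold_order {} E" by (auto simp: threshold_order_def)
  moreover have "split_by E True V {}" by (simp add: split_by_def)
  ultimately show ?thesis by blast
qed

text \<open>The parity of a triple \<open>u < v < w\<close> of a threshold order is the colour of its middle vertex, so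
  reversing an order only costs a switching. Around a vertex \<open>x\<close> that has been made isolated, the
  order is therefore \<open>A\<close>, then \<open>x\<close>, then the reversal of \<open>B\<close>.\<close>

lemma threshold_parts_switching:
  fixes E :: "'a \<Rightarrow> 'a \<Rightarrow> bool"
  assumes sym: "symp E" and iso: "\<forall>u\<in>A \<union> B. \<not> E x u" and x: "x \<notin> A \<union> B"
    and AB: "split_by E c A B" "threshold_order A E" "threshold_order B E"
  shows "\<exists>S :: 'a \<Rightarrow> bool. threshold_order (insert x (A \<union> B)) (\<lambda>u v. E u v \<noteq> (S u \<noteq> S v))"
proof -
  obtain xs t where xs: "distinct xs" "set xs = A" "sorted_wrt (\<lambda>u v. E u v = t v) xs"
    using AB(2) unfolding threshold_order_def by blast
  obtain ys r where ys: "distinct ys" "set ys = B" "sorted_wrt (\<lambda>u v. E u v = r v) ys"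
    using AB(3) unfolding threshold_order_def by blast
  \<comment> \<open>On \<open>A\<close> the switching is constant and changes nothing. Between
    \<open>A\<close> and \<open>x\<close> it turns non-adjacency into colour \<open>c\<close>. From
    \<open>A\<close> or \<open>x\<close> to \<open>v\<close> in \<open>B\<close> the result is
    \<open>r v\<close>. Inside \<open>B\<close> it turns \<open>r u\<close>, the colour of the later
    vertex of \<open>ys\<close>, into \<open>r v\<close>, which is what the reversed order
    needs.\<close>
  define S where "S u = (if u \<in> A then c else u \<in> B \<and> r u)" for u
  define q where "q u = (if u \<in> A then t u else if u \<in> B then r u else c)" for u
  have disj: "A \<inter> B = {}" using AB(1) by (simp add: split_by_def)
  let ?P = "\<lambda>u v. (E u v \<noteq> (S u \<noteq> S v)) = q v"
  have inA: "S u = c" "q u = t u" if "u \<in> A" for u using that by (simp_all add: S_def q_def)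
  have inB: "S u = r u" "q u = r u" if "u \<in> B" for u
    using that disj by (auto simp: S_def q_def)
  have atx: "S x = False" "q x = c" using x by (auto simp: S_def q_def)
  have "sorted_wrt ?P xs"
    using xs(3) by (rule sorted_wrt_mono_rel[rotated]) (simp add: xs(2) inA)
  moreover have "sorted_wrt ?P (rev ys)"
    unfolding sorted_wrt_rev using ys(3)
    by (rule sorted_wrt_mono_rel[rotated])
      (simp add: ys(2) inB symp_commute[OF sym, of y x for x y], blast)
  moreover have "?P u x" if "u \<in> A" for u
    using that iso inA atx symp_commute[OF sym, of u x] by simp
  moreover have "?P x v" if "v \<in> B" for v
    using that iso inB atx by simp
  moreover have "?P u v" if "u \<in> A" "v \<in> B" for u v
    using that inA inB AB(1) by (auto simp: split_by_def)
  ultimately have "sorted_wrt ?P (xs @ x # rev ys)"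
    by (simp add: sorted_wrt_append xs(2) ys(2))
  moreover have "distinct (xs @ x # rev ys)" "set (xs @ x # rev ys) = insert x (A \<union> B)"
    using xs ys disj x by auto
  ultimately show ?thesis unfolding threshold_order_def by blast
qed

subsection \<open>Switching graphs and the forbidden configurations\<close>

lemma switch_embedsI:
  assumes "inj_on g (verts K)" "g ` verts K \<subseteq> V"
    and "\<And>i j. i \<in> verts K \<Longrightarrow> j \<in> verts K \<Longrightarrow> i \<noteq> j \<Longrightarrow>
      ({i, j} \<in> edges K) = (E (g i) (g j) \<noteq> (s i \<noteq> (s j :: bool)))"
  shows "switch_embeds K V E"
  unfolding switch_embeds_def by (intro exI[of _ g] exI[of _ s] conjI ballI impI assms)

lemma verts_switch: "verts (switch G S) = verts G"
  by (simp add: switch_def)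

lemma verts_induced: "verts (induced G W) = W"
  by (simp add: induced_def)

lemma edge_switch:
  assumes "S \<subseteq> verts G" "u \<in> verts G" "v \<in> verts G"
  shows "{u, v} \<in> edges (switch G S) \<longleftrightarrow> ({u, v} \<in> edges G) \<noteq> ((u \<in> S) \<noteq> (v \<in> S))"
proof -
  have "{u, v} \<in> cut_pairs G S \<longleftrightarrow> (u \<in> S \<and> v \<in> verts G - S) \<or> (v \<in> S \<and> u \<in> verts G - S)"
    unfolding cut_pairs_def mem_Collect_eq doubleton_eq_iff by blast
  with assms have "{u, v} \<in> cut_pairs G S \<longleftrightarrow> ((u \<in> S) \<noteq> (v \<in> S))" by blast
  then show ?thesis by (auto simp: switch_def)
qed

lemma no_loop: "fin_simple_graph G \<Longrightarrow> {u, u} \<notin> edges G"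
  by (auto simp: fin_simple_graph_def)

text \<open>An isomorphism onto \<open>K\<close> is inverted to an embedding \<open>g\<close>;
  membership in \<open>S\<close> is pulled back along \<open>g\<close>, and conversely
  \<open>S\<close> is the image of the points where \<open>s\<close> holds.\<close>

lemma switching_equivalent_to_copy_iff_switch_embeds:
  assumes G: "fin_simple_graph G" and K: "fin_simple_graph K"
  shows "(\<exists>W\<subseteq>verts G. switching_equivalent_to_copy (induced G W) K) \<longleftrightarrow>
    switch_embeds K (verts G) (\<lambda>u v. {u, v} \<in> edges G)"
proof
  assume "\<exists>W\<subseteq>verts G. switching_equivalent_to_copy (induced G W) K"
  then obtain W S where W: "W \<subseteq> verts G" and S: "S \<subseteq> W"
    and iso: "isomorphic (switch (induced G W) S) K"
    unfolding switching_equivalent_to_copy_def switching_equivalent_def verts_induced by blast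
  then obtain f where f: "bij_betw f W (verts K)"
    and fK: "\<forall>u\<in>W. \<forall>v\<in>W. {u, v} \<in> edges (switch (induced G W) S) \<longleftrightarrow> {f u, f v} \<in> edges K"
    unfolding isomorphic_def verts_switch verts_induced by blast
  define g where "g = the_inv_into W f"
  have g: "bij_betw g (verts K) W" unfolding g_def by (rule bij_betw_the_inv_into[OF f])
  have fg: "f (g i) = i" "g i \<in> W" if "i \<in> verts K" for i
    using f_the_inv_into_f_bij_betw[OF f] that bij_betwE[OF g] by (auto simp: g_def)
  have "({i, j} \<in> edges K) = (({g i, g j} \<in> edges G) \<noteq> ((g i \<in> S) \<noteq> (g j \<in> S)))"
    if "i \<in> verts K" "j \<in> verts K" for i j
  proof -
    have "({i, j} \<in> edges K) = ({g i, g j} \<in> edges (switch (induced G W) S))"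
      using fK fg that by simp
    also have "\<dots> = (({g i, g j} \<in> edges (induced G W)) \<noteq> ((g i \<in> S) \<noteq> (g j \<in> S)))"
      using S fg that by (intro edge_switch) (simp_all add: verts_induced)
    also have "({g i, g j} \<in> edges (induced G W)) = ({g i, g j} \<in> edges G)"
      using fg that by (simp add: induced_def)
    finally show ?thesis .
  qed
  then show "switch_embeds K (verts G) (\<lambda>u v. {u, v} \<in> edges G)"
    using g W unfolding bij_betw_def
    by (intro switch_embedsI[of g _ _ _ "\<lambda>i. g i \<in> S"]) auto
next
  assume "switch_embeds K (verts G) (\<lambda>u v. {u, v} \<in> edges G)"
  then obtain g s where g: "inj_on g (verts K)" "g ` verts K \<subseteq> verts G"
    and gK: "\<forall>i\<in>verts K. \<forall>j\<in>verts K. i \<noteq> j \<longrightarrow>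
      ({i, j} \<in> edges K) = (({g i, g j} \<in> edges G) \<noteq> (s i \<noteq> (s j :: bool)))"
    unfolding switch_embeds_def by blast
  define W where "W = g ` verts K"
  define S where "S = g ` {i \<in> verts K. s i}"
  define f where "f = the_inv_into (verts K) g"
  have S: "S \<subseteq> W" by (auto simp: S_def W_def)
  have f: "bij_betw f W (verts K)"
    unfolding f_def by (rule bij_betw_the_inv_into) (simp add: g W_def bij_betw_def)
  have "({g i, g j} \<in> edges (switch (induced G W) S)) = ({f (g i), f (g j)} \<in> edges K)"
    if ij: "i \<in> verts K" "j \<in> verts K" for i j
  proof -
    have mem: "g k \<in> S \<longleftrightarrow> s k" if "k \<in> verts K" for k
      using that g(1) by (auto simp: S_def inj_on_def)
    have "({g i, g j} \<in> edges (switch (induced G W) S)) =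
        (({g i, g j} \<in> edges (induced G W)) \<noteq> ((g i \<in> S) \<noteq> (g j \<in> S)))"
      using S ij by (intro edge_switch) (simp_all add: verts_induced W_def)
    also have "\<dots> = (({g i, g j} \<in> edges G) \<noteq> (s i \<noteq> s j))"
      using ij mem by (simp add: induced_def W_def)
    \<comment> \<open>\<open>switch_embeds\<close> says nothing about \<open>i = j\<close>, but
      \<open>isomorphic\<close> does; there both sides are false for lack of loops.\<close>
    also have "\<dots> = ({i, j} \<in> edges K)"
      using gK[rule_format, OF ij] no_loop[OF G, of "g i"] no_loop[OF K, of i] by (cases "i = j") simp_all
    finally show ?thesis using ij g(1) by (simp add: f_def the_inv_into_f_f)
  qed
  then have "isomorphic (switch (induced G W) S) K"
    using f unfolding isomorphic_def verts_switch verts_induced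
    by (intro exI[of _ f]) (simp add: W_def)
  then have "switching_equivalent_to_copy (induced G W) K"
    using S unfolding switching_equivalent_to_copy_def switching_equivalent_def verts_induced
    by blast
  then show "\<exists>W\<subseteq>verts G. switching_equivalent_to_copy (induced G W) K"
    using g(2) unfolding W_def by blast
qed

text \<open>Switchings compose by exclusive or, so the switching by \<open>S\<close> is absorbed
  into \<open>s\<close>.\<close>

lemma switch_embeds_switch:
  fixes S :: "'a \<Rightarrow> bool"
  assumes "switch_embeds K V F"
    and F: "\<And>u v. u \<in> V \<Longrightarrow> v \<in> V \<Longrightarrow> F u v = (E u v \<noteq> (S u \<noteq> S v))"
  shows "switch_embeds K V E"
proof -
  from assms(1) obtain g s where g: "inj_on g (verts K)" "g ` verts K \<subseteq> V"
    and gK: "\<forall>i\<in>verts K. \<forall>j\<in>verts K. i \<noteq> j \<longrightarrow>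
      ({i, j} \<in> edges K) = (F (g i) (g j) \<noteq> (s i \<noteq> (s j :: bool)))"
    unfolding switch_embeds_def by blast
  have "({i, j} \<in> edges K) = (E (g i) (g j) \<noteq> ((s i \<noteq> S (g i)) \<noteq> (s j \<noteq> S (g j))))"
    if "i \<in> verts K" "j \<in> verts K" "i \<noteq> j" for i j
  proof -
    have "({i, j} \<in> edges K) = (F (g i) (g j) \<noteq> (s i \<noteq> s j))" using that by (rule gK[rule_format])
    also have "F (g i) (g j) = (E (g i) (g j) \<noteq> (S (g i) \<noteq> S (g j)))"
      using g(2) that by (intro F) auto
    finally show ?thesis
      by (cases "s i"; cases "s j"; cases "S (g i)"; cases "S (g j)") simp_all
  qed
  with g show ?thesis by (rule switch_embedsI)
qed

section \<open>Threshold graphs, alternating 4-cycles and threshold orders\<close>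

text \<open>On the four vertices of an alternating 4-cycle, each vertex has both a neighbour and a
  non-neighbour.\<close>

lemma threshold_graph_no_alternating:
  assumes "threshold_graph H" and V: "a \<in> verts H" "b \<in> verts H" "c \<in> verts H" "d \<in> verts H"
  shows "\<not> alternating (\<lambda>u v. {u, v} \<in> edges H) a b c d"
proof
  assume alt: "alternating (\<lambda>u v. {u, v} \<in> edges H) a b c d"
  define W where "W = {a, b, c, d}"
  have "W \<subseteq> verts H" "W \<noteq> {}" using V by (auto simp: W_def)
  with assms(1) obtain v
    where v: "isolated_vertex (induced H W) v \<or> universal_vertex (induced H W) v"
    unfolding threshold_graph_def by blast
  then have "v \<in> W" by (auto simp: isolated_vertex_def universal_vertex_def induced_def)
  have "{a, b} \<in> edges H" "{b, a} \<in> edges H" "{c, d} \<in> edges H" "{d, c} \<in> edges H"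
    "{a, c} \<notin> edges H" "{c, a} \<notin> edges H" "{b, d} \<notin> edges H" "{d, b} \<notin> edges H"
    "distinct [a, b, c, d]"
    using alt unfolding alternating_def by (simp_all add: insert_commute)
  then have "\<exists>u\<in>W. {u, v} \<in> edges H" "\<exists>u\<in>W - {v}. {u, v} \<notin> edges H"
    using \<open>v \<in> W\<close> unfolding W_def by auto
  with v \<open>v \<in> W\<close> show False
    unfolding isolated_vertex_def universal_vertex_def induced_def by auto
qed

text \<open>The last vertex of the order that lies in \<open>W\<close> is isolated or universal in
  the subgraph induced by \<open>W\<close>, according to \<open>t\<close>.\<close>

lemma threshold_graph_of_order:
  assumes H: "fin_simple_graph H" and ord: "threshold_order (verts H) (\<lambda>u v. {u, v} \<in> edges H)"
  shows "threshold_graph H"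
proof -
  obtain xs t where xs: "distinct xs" "set xs = verts H"
    "sorted_wrt (\<lambda>u v. ({u, v} \<in> edges H) = t v) xs"
    using ord unfolding threshold_order_def by blast
  have "\<exists>v. isolated_vertex (induced H W) v \<or> universal_vertex (induced H W) v"
    if "sorted_wrt (\<lambda>u v. ({u, v} \<in> edges H) = t v) ys" "W \<subseteq> set ys" "W \<noteq> {}" for W ys
    using that
  proof (induction ys rule: rev_induct)
    case Nil
    then show ?case by simp
  next
    case (snoc v ys)
    show ?case
    proof (cases "v \<in> W")
      case False
      with snoc show ?thesis by (auto simp: sorted_wrt_append)
    next
      case True
      have "({u, v} \<in> edges H) = (t v \<and> u \<noteq> v)" if "u \<in> W" for u
        using snoc.prems(1,2) that no_loop[OF H, of v] by (auto simp: sorted_wrt_append)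
      then have "if t v then universal_vertex (induced H W) v else isolated_vertex (induced H W) v"
        using True by (auto simp: isolated_vertex_def universal_vertex_def induced_def)
      then show ?thesis by (auto split: if_splits)
    qed
  qed
  with xs H show ?thesis unfolding threshold_graph_def by simp
qed

section \<open>Switchings of the three forbidden graphs\<close>

lemma fin_simple_forbidden:
  "fin_simple_graph graph_3K2" "fin_simple_graph graph_C5" "fin_simple_graph graph_C4_2K1"
  by (auto simp: fin_simple_graph_def graph_3K2_def graph_C5_def graph_C4_2K1_def)

lemma switch_embeds_alternating:
  assumes K: "K \<in> {graph_3K2, graph_C5, graph_C4_2K1}" and emb: "switch_embeds K V E"
  shows "\<exists>a\<in>V. \<exists>b\<in>V. \<exists>c\<in>V. \<exists>d\<in>V. alternating E a b c d"
proof -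
  obtain g s where g: "inj_on g (verts K)" "g ` verts K \<subseteq> V"
    and gK: "\<forall>i\<in>verts K. \<forall>j\<in>verts K. i \<noteq> j \<longrightarrow>
      ({i, j} \<in> edges K) = (E (g i) (g j) \<noteq> (s i \<noteq> (s j :: bool)))"
    using emb unfolding switch_embeds_def by blast
  \<comment> \<open>\<open>F\<close> is \<open>K\<close> switched by \<open>s\<close>. It lives on
    numerals, so finding a quadruple is a propositional problem in the values of \<open>s\<close>;
    injectivity of \<open>g\<close> carries the quadruple back to \<open>V\<close>.\<close>
  define F where "F i j = (({i, j} \<in> edges K) \<noteq> (s i \<noteq> s j))" for i j
  have F: "E (g i) (g j) = F i j" if "i \<in> verts K" "j \<in> verts K" "i \<noteq> j" for i j
    unfolding F_def gK[rule_format, OF that] by argo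
  have "\<exists>a\<in>verts K. \<exists>b\<in>verts K. \<exists>c\<in>verts K. \<exists>d\<in>verts K. alternating F a b c d"
  proof (rule ccontr)
    assume "\<not> ?thesis"
    then have n: "\<not> alternating F a b c d"
      if "a \<in> verts K" "b \<in> verts K" "c \<in> verts K" "d \<in> verts K" for a b c d
      using that by blast
    \<comment> \<open>For each \<open>K\<close>, every one of the \<open>2\<^sup>6\<close> or \<open>2\<^sup>5\<close> switchings makes one of the quadruples
      listed below alternating.\<close>
    note n = n[unfolded alternating_def F_def]
    from K consider "K = graph_3K2" | "K = graph_C5" | "K = graph_C4_2K1" by blast
    then show False
    proof cases
      case 1
      show False
        using n[of 0 1 2 3] n[of 0 2 1 3] n[of 0 3 1 2] n[of 0 1 4 5] n[of 0 4 5 2] n[of 0 5 4 2]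
          n[of 2 3 4 5] n[of 0 3 2 4] n[of 0 4 2 1] n[of 0 2 3 4] n[of 0 2 4 1] n[of 0 3 2 5]
          n[of 0 5 1 4]
        by (simp add: 1 graph_3K2_def doubleton_eq_iff) argo
    next
      case 2
      show False
        using n[of 0 1 2 3] n[of 0 2 1 3] n[of 0 2 4 1] n[of 0 3 1 4] n[of 0 3 4 2] n[of 1 3 2 4]
          n[of 0 1 3 4] n[of 0 4 2 1] n[of 0 4 3 2] n[of 1 2 3 4]
        by (simp add: 2 graph_C5_def doubleton_eq_iff) argo
    next
      case 3
      show False
        using n[of 0 1 2 3] n[of 0 1 3 2] n[of 0 2 1 3] n[of 0 4 2 5] n[of 0 4 5 1] n[of 0 5 4 1]
          n[of 1 4 3 5] n[of 0 1 3 4] n[of 0 1 4 2] n[of 0 1 3 5] n[of 0 1 5 2] n[of 0 3 1 4]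
          n[of 0 4 1 2]
        by (simp add: 3 graph_C4_2K1_def doubleton_eq_iff) argo
    qed
  qed
  then obtain a b c d where abcd: "a \<in> verts K" "b \<in> verts K" "c \<in> verts K" "d \<in> verts K"
    and alt: "alternating F a b c d"
    by blast
  then have "distinct [a, b, c, d]" by (simp add: alternating_def)
  with abcd g(1) have "distinct [g a, g b, g c, g d]" by (simp add: inj_on_eq_iff)
  with alt abcd F have "alternating E (g a) (g b) (g c) (g d)" by (simp add: alternating_def)
  with abcd g(2) show ?thesis by blast
qed

text \<open>Switching C5 at the two neighbours of a vertex isolates that vertex and turns the other
  four into a P4.\<close>

lemma isolated_path4_switch_embeds:
  assumes "symp E" "path4 E a b c d" "{x, a, b, c, d} \<subseteq> V" "x \<notin> {a, b, c, d}"
    and "\<forall>u\<in>{a, b, c, d}. \<not> E x u"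
  shows "switch_embeds graph_C5 V E"
  unfolding switch_embeds_def graph_C5_def
  by (intro exI[of _ "(!) [x, a, c, b, d]"] exI[of _ "\<lambda>i. i = 1 \<or> i = 4"])
    (use assms(2-5) in \<open>simp add: path4_def doubleton_eq_iff symp_commute[OF assms(1)]; blast\<close>)

text \<open>Switching 3K2 at one vertex \<open>z\<close> isolates its partner \<open>x\<close> and
  makes \<open>z\<close> the centre of a bowtie.\<close>

lemma isolated_bowtie_switch_embeds:
  assumes "symp E" "matching2 E a b c d" "{x, z, a, b, c, d} \<subseteq> V" "x \<notin> {z, a, b, c, d}"
    and "\<forall>u\<in>{z, a, b, c, d}. \<not> E x u" and "z \<notin> {a, b, c, d}" "\<forall>u\<in>{a, b, c, d}. E z u"
  shows "switch_embeds graph_3K2 V E"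
  unfolding switch_embeds_def graph_3K2_def
  by (intro exI[of _ "(!) [x, z, a, b, c, d]"] exI[of _ "\<lambda>i. i = 1"])
    (use assms(2-) in \<open>simp add: matching2_def doubleton_eq_iff symp_commute[OF assms(1)]; blast\<close>)

lemma isolated_cycle4_point_switch_embeds:
  assumes "symp E" "cycle4 E a b c d" "{x, z, a, b, c, d} \<subseteq> V" "x \<notin> {z, a, b, c, d}"
    and "\<forall>u\<in>{z, a, b, c, d}. \<not> E x u" and "z \<notin> {a, b, c, d}" "\<forall>u\<in>{a, b, c, d}. \<not> E z u"
  shows "switch_embeds graph_C4_2K1 V E"
  unfolding switch_embeds_def graph_C4_2K1_def
  by (intro exI[of _ "(!) [a, b, c, d, x, z]"] exI[of _ "\<lambda>i. False"])
    (use assms(2-) in \<open>simp add: cycle4_def doubleton_eq_iff symp_commute[OF assms(1)]; blast\<close>)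

lemma matching3_switch_embeds:
  assumes "symp E" "matching2 E a b c d" "matching2 E a b e f" "matching2 E c d e f"
    and "{a, b, c, d, e, f} \<subseteq> V"
  shows "switch_embeds graph_3K2 V E"
  unfolding switch_embeds_def graph_3K2_def
  by (intro exI[of _ "(!) [a, b, c, d, e, f]"] exI[of _ "\<lambda>i. False"])
    (use assms(2-) in \<open>simp add: matching2_def doubleton_eq_iff symp_commute[OF assms(1)]; blast\<close>)

text \<open>Switching C4 + 2K1 at its two isolated vertices joins them to the whole cycle and gives
  the octahedron, the complement of 3K2.\<close>

lemma matching3_compl_switch_embeds:
  assumes "symp E" "cycle4 E a c b d" "cycle4 E a e b f" "cycle4 E c e d f"
    and "{a, b, c, d, e, f} \<subseteq> V"
  shows "switch_embeds graph_C4_2K1 V E"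
  unfolding switch_embeds_def graph_C4_2K1_def
  by (intro exI[of _ "(!) [c, e, d, f, a, b]"] exI[of _ "\<lambda>i. i = 4 \<or> i = 5"])
    (use assms(2-) in \<open>simp add: cycle4_def doubleton_eq_iff symp_commute[OF assms(1)]; blast\<close>)

section \<open>From excluded embeddings to the characterisation\<close>

lemma no_switch_embeds_threshold_order:
  fixes E :: "'a \<Rightarrow> 'a \<Rightarrow> bool"
  assumes fin: "finite V" and sym: "symp E"
    and no: "\<not> switch_embeds graph_3K2 V E" "\<not> switch_embeds graph_C5 V E"
      "\<not> switch_embeds graph_C4_2K1 V E"
  shows "\<exists>S :: 'a \<Rightarrow> bool. threshold_order V (\<lambda>u v. E u v \<noteq> (S u \<noteq> S v))"
proof (cases "V = {}")
  case True
  then show ?thesis by (simp add: threshold_order_def)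
next
  case False
  then obtain x where x: "x \<in> V" by blast
  \<comment> \<open>Switching at the neighbours of \<open>x\<close> isolates \<open>x\<close>. The
    guard \<open>u \<noteq> x\<close> keeps \<open>x\<close> outside the set, since \<open>E\<close>
    is not assumed irreflexive.\<close>
  define N where "N u \<longleftrightarrow> u \<noteq> x \<and> E x u" for u
  define F where "F u v = (E u v \<noteq> (N u \<noteq> N v))" for u v
  define U where "U = V - {x}"
  have symF: "symp F" using sympD[OF sym] unfolding F_def by (intro sympI) blast
  have iso: "\<not> F x u" if "u \<in> U" for u using that by (simp add: F_def N_def U_def)
  have noF: "\<not> switch_embeds graph_3K2 V F" "\<not> switch_embeds graph_C5 V F"
    "\<not> switch_embeds graph_C4_2K1 V F"
    using no switch_embeds_switch[of _ V F E N] F_def by blast+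
  have U: "y \<in> V" "y \<noteq> x" if "y \<in> U" for y using that by (auto simp: U_def)
  have p4: "path4_free U F"
    unfolding path4_free_def
  proof (intro ballI notI)
    fix a b c d
    assume *: "a \<in> U" "b \<in> U" "c \<in> U" "d \<in> U" "path4 F a b c d"
    then have "switch_embeds graph_C5 V F"
      using x iso U by (intro isolated_path4_switch_embeds[OF symF *(5), of x]) auto
    with noF show False by blast
  qed
  have c4: "cycle4_point_free U F"
    unfolding cycle4_point_free_def
  proof (intro ballI impI, rule ccontr)
    fix a b c d z
    assume *: "a \<in> U" "b \<in> U" "c \<in> U" "d \<in> U" "z \<in> U - {a, b, c, d}" "cycle4 F a b c d"
      "\<not> (F z a \<or> F z b \<or> F z c \<or> F z d)"
    then have "switch_embeds graph_C4_2K1 V F"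
      using x iso U by (intro isolated_cycle4_point_switch_embeds[OF symF *(6), of x z]) auto
    with noF show False by blast
  qed
  have bow: "bowtie_free U F"
    unfolding bowtie_free_def
  proof (intro ballI impI notI)
    fix a b c d z
    assume *: "a \<in> U" "b \<in> U" "c \<in> U" "d \<in> U" "z \<in> U - {a, b, c, d}" "matching2 F a b c d"
      "F z a \<and> F z b \<and> F z c \<and> F z d"
    then have "switch_embeds graph_3K2 V F"
      using x iso U by (intro isolated_bowtie_switch_embeds[OF symF *(6), of x z]) auto
    with noF show False by blast
  qed
  have m3: "matching3_free U F"
    unfolding matching3_free_def
  proof (intro ballI notI)
    fix a b c d e f
    assume *: "a \<in> U" "b \<in> U" "c \<in> U" "d \<in> U" "e \<in> U" "f \<in> U"
      and "matching2 F a b c d \<and> matching2 F a b e f \<and> matching2 F c d e f"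
    then have "switch_embeds graph_3K2 V F"
      using U(1) by (intro matching3_switch_embeds[OF symF, of a b c d e f]) auto
    with noF show False by blast
  qed
  have m3': "matching3_free U (\<lambda>u v. \<not> F u v)"
    unfolding matching3_free_def matching2_compl[OF symF]
  proof (intro ballI notI)
    fix a b c d e f
    assume *: "a \<in> U" "b \<in> U" "c \<in> U" "d \<in> U" "e \<in> U" "f \<in> U"
      and "cycle4 F a c b d \<and> cycle4 F a e b f \<and> cycle4 F c e d f"
    then have "switch_embeds graph_C4_2K1 V F"
      using U(1) by (intro matching3_compl_switch_embeds[OF symF, of a c b d e f]) auto
    with noF show False by blast
  qed
  have "finite U" using fin by (simp add: U_def)
  from two_threshold_parts[OF this symF p4 c4 bow m3 m3']
  obtain A B c where AB: "A \<union> B = U" "split_by F c A B" "threshold_order A F"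
    "threshold_order B F"
    by blast
  have "\<exists>S :: 'a \<Rightarrow> bool. threshold_order (insert x (A \<union> B)) (\<lambda>u v. F u v \<noteq> (S u \<noteq> S v))"
    by (rule threshold_parts_switching[OF symF _ _ AB(2-4)]) (auto simp: AB(1) iso U_def)
  moreover have "insert x (A \<union> B) = V" using AB(1) x by (auto simp: U_def)
  ultimately obtain S :: "'a \<Rightarrow> bool"
    where S: "threshold_order V (\<lambda>u v. F u v \<noteq> (S u \<noteq> S v))"
    by auto
  have "(\<lambda>u v. F u v \<noteq> (S u \<noteq> S v)) =
      (\<lambda>u v. E u v \<noteq> ((N u \<noteq> S u) \<noteq> (N v \<noteq> S v)))"
    unfolding F_def by (intro ext) argo
  with S have "threshold_order V (\<lambda>u v. E u v \<noteq> ((N u \<noteq> S u) \<noteq> (N v \<noteq> S v)))" by simp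
  then show ?thesis by (rule exI[of _ "\<lambda>u. N u \<noteq> S u"])
qed

lemma threshold_order_cong:
  assumes "threshold_order V E" "\<And>u v. u \<in> V \<Longrightarrow> v \<in> V \<Longrightarrow> E u v = F u v"
  shows "threshold_order V F"
proof -
  obtain xs t where xs: "distinct xs" "set xs = V" "sorted_wrt (\<lambda>u v. E u v = t v) xs"
    using assms(1) unfolding threshold_order_def by blast
  from xs(3) have "sorted_wrt (\<lambda>u v. F u v = t v) xs"
    by (rule sorted_wrt_mono_rel[rotated]) (simp add: xs(2) assms(2))
  with xs show ?thesis unfolding threshold_order_def by blast
qed

theorem theorem7:
  fixes G :: "'a ugraph"
  assumes "fin_simple_graph G"
  shows "(\<exists>H. threshold_graph H \<and> switching_equivalent G H) \<longleftrightarrow>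
    \<not> (\<exists>W\<subseteq>verts G.
         switching_equivalent_to_copy (induced G W) graph_3K2 \<or>
         switching_equivalent_to_copy (induced G W) graph_C5 \<or>
         switching_equivalent_to_copy (induced G W) graph_C4_2K1)"
proof -
  let ?E = "\<lambda>u v. {u, v} \<in> edges G"
  let ?Ks = "{graph_3K2, graph_C5, graph_C4_2K1}"
  have fin: "finite (verts G)" using assms by (simp add: fin_simple_graph_def)
  have sym: "symp ?E" by (simp add: symp_def insert_commute)
  have emb: "(\<exists>W\<subseteq>verts G.
         switching_equivalent_to_copy (induced G W) graph_3K2 \<or>
         switching_equivalent_to_copy (induced G W) graph_C5 \<or>
         switching_equivalent_to_copy (induced G W) graph_C4_2K1) \<longleftrightarrow>
      (\<exists>K\<in>?Ks. switch_embeds K (verts G) ?E)"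
    using fin_simple_forbidden[THEN switching_equivalent_to_copy_iff_switch_embeds[OF assms]]
    by auto
  have "\<not> switch_embeds K (verts G) ?E"
    if H: "threshold_graph H" "switching_equivalent G H" and K: "K \<in> ?Ks" for H K
  proof
    assume emb: "switch_embeds K (verts G) ?E"
    obtain S where S: "S \<subseteq> verts G" "H = switch G S"
      using H(2) by (auto simp: switching_equivalent_def)
    have "switch_embeds K (verts G) (\<lambda>u v. {u, v} \<in> edges H)"
      using emb by (rule switch_embeds_switch[where S = "\<lambda>u. u \<in> S"])
        (use edge_switch[OF S(1)] S(2) in blast)
    from switch_embeds_alternating[OF K this] threshold_graph_no_alternating[OF H(1)]
    show False using S(2) by (auto simp: verts_switch)
  qed
  moreover have "\<exists>H. threshold_graph H \<and> switching_equivalent G H"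
    if no: "\<And>K. K \<in> ?Ks \<Longrightarrow> \<not> switch_embeds K (verts G) ?E"
  proof -
    obtain s :: "'a \<Rightarrow> bool"
      where s: "threshold_order (verts G) (\<lambda>u v. ?E u v \<noteq> (s u \<noteq> s v))"
      using no_switch_embeds_threshold_order[OF fin sym] no by auto
    \<comment> \<open>\<open>s\<close> is arbitrary off the vertex set, whereas a switching set must
      lie inside it.\<close>
    define S where "S = {u \<in> verts G. s u}"
    have S: "S \<subseteq> verts G" by (auto simp: S_def)
    have "threshold_order (verts G) (\<lambda>u v. {u, v} \<in> edges (switch G S))"
      using s by (rule threshold_order_cong) (simp add: edge_switch[OF S], simp add: S_def)
    then have "threshold_graph (switch G S)"
      using fin_simple_graph_switch[OF assms S]
      by (intro threshold_graph_of_order) (simp_all add: verts_switch)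
    with S show ?thesis unfolding switching_equivalent_def by blast
  qed
  ultimately show ?thesis unfolding emb by blast
qed

end
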